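(* Let $\mu$ and $\nu$ be two probability measures supported on $[\lambda_{\min},\lambda_{\max}]$, let $J\Subset I_{\mathrm{int}}$ be a fixed compact interval, and assume that $m$ is Lipschitz continuous with Lipschitz constant $L_m$. Then $$0\le H_{\mu,J}(u_\nu^* )-H_{\mu,J}(u_\mu^* )\le\frac{L_m^2\,|J|}{\lambda_{\min}^4}\,W_1(\mu,\nu)^2,$$ where $$H_{\mu,J}(u):=\int_J\mathbb E_\mu\left[\left(u(t)-D\left(t+\frac1\lambda\right)\right)^2\right]\mathrm dt.$$
   Context: Here $0<\lambda_{\min}<\lambda_{\max}$, $T>0$, and $$I_{\mathrm{int}}:=\left[\frac1{\lambda_{\min}}-\frac1{\lambda_{\max}},\,T-\frac1{\lambda_{\min}}\right]$$ is assumed nonempty. $D:[0,T]\times\Omega\to[0,\infty)$ is a jointly measurable stochastic process with $D\in L^2(\Omega\times(0,T))$, and $m(t):=\mathbb E[D(t)]$, $t\in[0,T]$. $\mathbb E_\mu$ denotes expectation when the random velocity $\lambda$ has law $\mu$ and is independent of the process $D$ (i.e. $\sigma(\lambda)$ and $\sigma(D(t):t\in[0,T])$ are independent). For $t\in J$, $$u_\mu^*(t):=\int_{\lambda_{\min}}^{\lambda_{\max}}m\left(t+\frac1\ell\right)\mu(\mathrm d\ell),\qquad u_\nu^*(t):=\int_{\lambda_{\min}}^{\lambda_{\max}}m\left(t+\frac1\ell\right)\nu(\mathrm d\ell).$$ $J\Subset I_{\mathrm{int}}$ means $J$ is a compact interval compactly contained in $I_{\mathrm{int}}$; $|J|$ is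 its length. $W_1$ denotes the Wasserstein-1 distance on probability measures over $[\lambda_{\min},\lambda_{\max}]$ with the cost $|\ell_1-\ell_2|$. *)

theory Defs
  imports "HOL-Probability.Probability"
begin

definition I_int :: "real \<Rightarrow> real \<Rightarrow> real \<Rightarrow> real set" where
  "I_int lmin lmax T = {1 / lmin - 1 / lmax .. T - 1 / lmin}"

text \<open>A Borel probability measure on the line with all its mass in a closed interval;
  for such an interval this says that the topological support lies in the interval.\<close>

definition prob_supported_on :: "real set \<Rightarrow> real measure \<Rightarrow> bool" where
  "prob_supported_on S \<mu> \<longleftrightarrow>
     prob_space \<mu> \<and> sets \<mu> = sets borel \<and> measure \<mu> S = 1"

definition couplings :: "real measure \<Rightarrow> real measure \<Rightarrow> (real \<times> real) measure set" where
  "couplings \<mu> \<nu> =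
     {\<pi>. sets \<pi> = sets (borel \<Otimes>\<^sub>M borel) \<and>
          distr \<pi> borel fst = \<mu> \<and> distr \<pi> borel snd = \<nu>}"

text \<open>Couplings live on the whole plane. If both marginals are supported on a common
  compact interval, every coupling is concentrated on its square, so this is the distance
  over that interval and it is finite.\<close>

definition wasserstein1 :: "real measure \<Rightarrow> real measure \<Rightarrow> ennreal" where
  "wasserstein1 \<mu> \<nu> =
     (INF \<pi>\<in>couplings \<mu> \<nu>. \<integral>\<^sup>+ z. ennreal \<bar>fst z - snd z\<bar> \<partial>\<pi>)"

definition sigma_process ::
    "'w measure \<Rightarrow> 'i set \<Rightarrow> ('i \<Rightarrow> 'w \<Rightarrow> real) \<Rightarrow> 'w set set" where
  "sigma_process M I X =
     sigma_sets (space M) (\<Union>i\<in>I. {X i -` B \<inter> space M | B. B \<in> sets borel})"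

text \<open>Only the values for times in the interval from 0 to T are constrained; the process is
  a total function in Isabelle, and its values at other times are irrelevant.\<close>

definition demand_process :: "'w measure \<Rightarrow> real \<Rightarrow> (real \<Rightarrow> 'w \<Rightarrow> real) \<Rightarrow> bool" where
  "demand_process M T D \<longleftrightarrow>
     (\<lambda>(t, \<omega>). D t \<omega>) \<in> borel_measurable (restrict_space borel {0..T} \<Otimes>\<^sub>M M) \<and>
     (\<forall>t\<in>{0..T}. \<forall>\<omega>\<in>space M. 0 \<le> D t \<omega>) \<and>
     integrable (M \<Otimes>\<^sub>M restrict_space lborel {0<..<T}) (\<lambda>(\<omega>, t). (D t \<omega>)\<^sup>2)"

text \<open>The random velocity takes its values in the given interval everywhere, not merely almost
  surely, so that the process is only ever evaluated at admissible times.\<close>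

definition velocity ::
    "'w measure \<Rightarrow> real \<Rightarrow> real \<Rightarrow> real \<Rightarrow> (real \<Rightarrow> 'w \<Rightarrow> real) \<Rightarrow> real measure \<Rightarrow> ('w \<Rightarrow> real) \<Rightarrow> bool"
  where
  "velocity M lmin lmax T D \<mu> \<Lambda> \<longleftrightarrow>
     \<Lambda> \<in> borel_measurable M \<and>
     (\<forall>\<omega>\<in>space M. \<Lambda> \<omega> \<in> {lmin..lmax}) \<and>
     distr M borel \<Lambda> = \<mu> \<and>
     prob_space.indep_set M (sigma_process M {()} (\<lambda>_. \<Lambda>)) (sigma_process M {0..T} D)"

definition mean_demand :: "'w measure \<Rightarrow> (real \<Rightarrow> 'w \<Rightarrow> real) \<Rightarrow> real \<Rightarrow> real" where
  "mean_demand M D t = (LINT \<omega>|M. D t \<omega>)"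

definition u_star ::
    "'w measure \<Rightarrow> (real \<Rightarrow> 'w \<Rightarrow> real) \<Rightarrow> real \<Rightarrow> real \<Rightarrow> real measure \<Rightarrow> real \<Rightarrow> real" where
  "u_star M D lmin lmax \<mu> t = (LINT l:{lmin..lmax}|\<mu>. mean_demand M D (t + 1 / l))"

text \<open>The measure \<open>\<mu>\<close> enters through the velocity \<open>\<Lambda>\<close>, whose law it is.\<close>

definition H_cost ::
    "'w measure \<Rightarrow> (real \<Rightarrow> 'w \<Rightarrow> real) \<Rightarrow> ('w \<Rightarrow> real) \<Rightarrow> real set \<Rightarrow> (real \<Rightarrow> real) \<Rightarrow> real" where
  "H_cost M D \<Lambda> J u =
     (LINT t:J|lborel. (LINT \<omega>|M. (u t - D (t + 1 / \<Lambda> \<omega>) \<omega>)\<^sup>2))"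

end

theory Submission
  imports Defs
begin

text \<open>The shear \<open>(t, \<omega>) \<mapsto> (t + 1 / \<Lambda> \<omega>, \<omega>)\<close> preserves the product of Lebesgue measure
  with the probability. Changing variables by it turns a time integral of \<open>D (t + 1 / \<Lambda>)\<close> against
  a weight into one of \<open>D s\<close> against a function of \<open>\<Lambda>\<close>, where only the independence of
  \<open>\<Lambda>\<close> from \<open>D s\<close> at fixed \<open>s\<close> is needed. So \<open>u_star\<close> for \<open>\<mu>\<close> acts as the mean of \<open>D (t + 1 / \<Lambda>)\<close> under
  the time integral, and the excess cost is \<open>\<integral>\<^bsub>J\<^esub> (u\<^sub>\<nu> - u\<^sub>\<mu>)\<^sup>2\<close>. Since \<open>l \<mapsto> m (t + 1 / l)\<close> is
  Lipschitz with constant \<open>L\<^sub>m / lmin\<^sup>2\<close>, integrating against any coupling bounds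
  \<open>\<bar>u\<^sub>\<nu> - u\<^sub>\<mu>\<bar>\<close> by that constant times the transport distance.

  The integrated form matters: \<open>D\<close> need not be jointly measurable for the sigma-algebra it
  generates, and for individual \<open>t\<close> the mean of \<open>D (t + 1 / \<Lambda>)\<close> may differ from \<open>u_star\<close>.\<close>

section \<open>Random time shifts of the product measure\<close>

text \<open>For fixed \<open>\<omega>\<close> the shear only translates the time section by
  \<open>a \<omega>\<close>, and Lebesgue measure is translation invariant. The measure of a set in
  the product is the integral over \<open>\<omega>\<close> of the measures of its time
  sections.\<close>

lemma distr_lborel_pair_shear:
  fixes a :: "'a \<Rightarrow> real"
  assumes "sigma_finite_measure M" and [measurable]: "a \<in> borel_measurable M"
  shows "distr (lborel \<Otimes>\<^sub>M M) (lborel \<Otimes>\<^sub>M M) (\<lambda>(t, \<omega>). (t + a \<omega>, \<omega>)) = lborel \<Otimes>\<^sub>M M"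
    (is "distr ?Q ?Q ?S = ?Q")
proof (rule measure_eqI)
  interpret M: sigma_finite_measure M by fact
  interpret pair_sigma_finite lborel M ..
  have S [measurable]: "?S \<in> measurable ?Q ?Q" by measurable
  show "sets (distr ?Q ?Q ?S) = sets ?Q" by simp
  fix A assume "A \<in> sets (distr ?Q ?Q ?S)"
  then have A [measurable]: "A \<in> sets ?Q" by simp
  have S': "?S -` A \<inter> space ?Q \<in> sets ?Q" using S A by (rule measurable_sets)
  have "emeasure lborel ((\<lambda>t. (t, \<omega>)) -` (?S -` A \<inter> space ?Q)) =
      emeasure lborel ((\<lambda>t. (t, \<omega>)) -` A)" if w: "\<omega> \<in> space M" for \<omega>
  proof -
    have B: "(\<lambda>t. (t, \<omega>)) -` A \<in> sets borel"
      using sets_Pair2[OF A] by simp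
    have "emeasure lborel ((\<lambda>t. (t, \<omega>)) -` A)
        = emeasure (distr lborel borel ((+) (a \<omega>))) ((\<lambda>t. (t, \<omega>)) -` A)"
      by (simp only: lborel_distr_plus)
    also have "\<dots> = emeasure lborel ((+) (a \<omega>) -` ((\<lambda>t. (t, \<omega>)) -` A) \<inter> space lborel)"
      using B by (intro emeasure_distr) auto
    also have "(+) (a \<omega>) -` ((\<lambda>t. (t, \<omega>)) -` A) \<inter> space lborel
        = (\<lambda>t. (t, \<omega>)) -` (?S -` A \<inter> space ?Q)"
      using w by (auto simp: space_pair_measure add.commute)
    finally show ?thesis by simp
  qed
  then show "emeasure (distr ?Q ?Q ?S) A = emeasure ?Q A"
    by (simp add: emeasure_distr[OF S A] emeasure_pair_measure_alt2[OF S']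
        emeasure_pair_measure_alt2[OF A] cong: nn_integral_cong)
qed

section \<open>Couplings and the transport distance\<close>

text \<open>Each marginal confines one coordinate to the interval almost surely, so the two
  coordinates differ by at most its length. The resulting cost bound keeps the transport distance
  finite, so that \<open>enn2real\<close> does not collapse it to 0.\<close>

lemma couplings_concentrated:
  assumes \<mu>: "prob_supported_on {a..b} \<mu>" and \<nu>: "prob_supported_on {a..b} \<nu>"
    and \<pi>: "\<pi> \<in> couplings \<mu> \<nu>"
  shows "prob_space \<pi>" "AE z in \<pi>. fst z \<in> {a..b} \<and> snd z \<in> {a..b}"
    "(\<integral>\<^sup>+ z. ennreal \<bar>fst z - snd z\<bar> \<partial>\<pi>) \<le> ennreal (b - a)"
proof -
  have sets [measurable_cong]: "sets \<pi> = sets (borel \<Otimes>\<^sub>M borel)"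
    and fst: "distr \<pi> borel fst = \<mu>" and snd: "distr \<pi> borel snd = \<nu>"
    using \<pi> by (auto simp: couplings_def)
  have [measurable]: "fst \<in> borel_measurable \<pi>" "snd \<in> borel_measurable \<pi>"
    by measurable
  interpret \<mu>: prob_space \<mu> using \<mu> by (simp add: prob_supported_on_def)
  interpret \<nu>: prob_space \<nu> using \<nu> by (simp add: prob_supported_on_def)
  show P: "prob_space \<pi>"
    by (rule prob_space_distrD[where f=fst and N=borel]) (simp_all add: fst \<mu>.prob_space_axioms)
  interpret \<pi>: prob_space \<pi> by fact
  have "AE x in \<mu>. x \<in> {a..b}" "AE x in \<nu>. x \<in> {a..b}"
    using \<mu> \<nu> \<mu>.AE_prob_1[of "{a..b}"] \<nu>.AE_prob_1[of "{a..b}"]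
    by (simp_all only: prob_supported_on_def)
  then have "AE z in \<pi>. fst z \<in> {a..b}" "AE z in \<pi>. snd z \<in> {a..b}"
    unfolding fst[symmetric] snd[symmetric] by (auto simp: AE_distr_iff)
  then show ae: "AE z in \<pi>. fst z \<in> {a..b} \<and> snd z \<in> {a..b}" by eventually_elim simp
  have "(\<integral>\<^sup>+ z. ennreal \<bar>fst z - snd z\<bar> \<partial>\<pi>) \<le> (\<integral>\<^sup>+ z. ennreal (b - a) \<partial>\<pi>)"
    using ae by (intro nn_integral_mono_AE, eventually_elim) (auto intro!: ennreal_leI)
  then show "(\<integral>\<^sup>+ z. ennreal \<bar>fst z - snd z\<bar> \<partial>\<pi>) \<le> ennreal (b - a)"
    by (simp add: \<pi>.emeasure_space_1)
qed

text \<open>Provides a coupling, so that the infimum in \<open>wasserstein1\<close> is not over the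
  empty set, where it would be infinite.\<close>

lemma pair_measure_in_couplings:
  assumes "prob_supported_on S \<mu>" "prob_supported_on S \<nu>"
  shows "\<mu> \<Otimes>\<^sub>M \<nu> \<in> couplings \<mu> \<nu>"
proof -
  have [measurable_cong]: "sets \<mu> = sets borel" "sets \<nu> = sets borel"
    using assms by (auto simp: prob_supported_on_def)
  interpret \<mu>: prob_space \<mu> using assms by (simp add: prob_supported_on_def)
  interpret \<nu>: prob_space \<nu> using assms by (simp add: prob_supported_on_def)
  interpret pair_prob_space \<mu> \<nu> ..
  have "distr (\<mu> \<Otimes>\<^sub>M \<nu>) borel fst = distr (\<mu> \<Otimes>\<^sub>M \<nu>) \<mu> fst"
    using assms by (intro distr_cong) (auto simp: prob_supported_on_def)
  also have "\<dots> = \<mu>" by (rule \<nu>.distr_pair_fst)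
  finally have 1: "distr (\<mu> \<Otimes>\<^sub>M \<nu>) borel fst = \<mu>" .
  have "distr (\<mu> \<Otimes>\<^sub>M \<nu>) borel snd = distr (\<mu> \<Otimes>\<^sub>M \<nu>) \<nu> snd"
    using assms by (intro distr_cong) (auto simp: prob_supported_on_def)
  also have "\<dots> = distr (distr (\<nu> \<Otimes>\<^sub>M \<mu>) (\<mu> \<Otimes>\<^sub>M \<nu>) (\<lambda>(x, y). (y, x))) \<nu> snd"
    by (subst distr_pair_swap) simp
  also have "\<dots> = distr (\<nu> \<Otimes>\<^sub>M \<mu>) \<nu> fst"
    by (subst distr_distr) (auto simp: comp_def case_prod_beta)
  also have "\<dots> = \<nu>" by (rule \<mu>.distr_pair_fst)
  finally show ?thesis
    using 1 assms by (auto simp: couplings_def prob_supported_on_def intro!: sets_pair_measure_cong)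
qed

text \<open>The easy half of Kantorovich-Rubinstein duality: both integrals are integrals against
  any coupling \<open>\<pi>\<close> of its two coordinates, so their difference is at most the
  \<open>\<pi>\<close>-integral of \<open>K * \<bar>fst z - snd z\<bar>\<close>. The infimum over
  \<open>\<pi>\<close> then gives the claim.\<close>

lemma set_integral_diff_le_wasserstein1:
  fixes f :: "real \<Rightarrow> real"
  assumes \<mu>: "prob_supported_on {a..b} \<mu>" and \<nu>: "prob_supported_on {a..b} \<nu>"
    and f: "K-lipschitz_on {a..b} f"
  shows "\<bar>(LINT x:{a..b}|\<mu>. f x) - (LINT x:{a..b}|\<nu>. f x)\<bar> \<le> K * enn2real (wasserstein1 \<mu> \<nu>)"
proof -
  \<comment> \<open>Extension by zero makes the integrand Borel on the whole line. Its jumps at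
    \<open>a\<close> and \<open>b\<close> do no harm, since couplings charge only the square, where
    \<open>g\<close> agrees with \<open>f\<close>.\<close>
  define g where "g x = indicator {a..b} x *\<^sub>R f x" for x
  define \<Delta> where "\<Delta> = \<bar>(LINT x:{a..b}|\<mu>. f x) - (LINT x:{a..b}|\<nu>. f x)\<bar>"
  let ?c = "\<lambda>\<pi>. \<integral>\<^sup>+ z. ennreal \<bar>fst z - snd z\<bar> \<partial>\<pi>"
  have K: "0 \<le> K" using f by (rule lipschitz_on_nonneg)
  have g [measurable]: "g \<in> borel_measurable borel"
    unfolding g_def
    by (intro borel_measurable_continuous_on_indicator lipschitz_on_continuous_on[OF f]) auto
  have "bounded (f ` {a..b})"
    by (intro compact_imp_bounded compact_continuous_image lipschitz_on_continuous_on[OF f]) auto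
  then obtain B where B: "\<And>x. x \<in> {a..b} \<Longrightarrow> norm (f x) \<le> B"
    unfolding bounded_iff by blast
  have gB: "norm (g x) \<le> \<bar>B\<bar>" for x
    using B[of x] by (auto simp: g_def indicator_def)
  have le: "ennreal \<Delta> \<le> ennreal K * ?c \<pi>" if \<pi>: "\<pi> \<in> couplings \<mu> \<nu>" for \<pi>
  proof -
    note p = couplings_concentrated[OF \<mu> \<nu> \<pi>]
    have [measurable_cong]: "sets \<pi> = sets (borel \<Otimes>\<^sub>M borel)"
      and fst: "distr \<pi> borel fst = \<mu>" and snd: "distr \<pi> borel snd = \<nu>"
      using \<pi> by (auto simp: couplings_def)
    interpret \<pi>: prob_space \<pi> by (rule p)
    have int: "integrable \<pi> (\<lambda>z. g (fst z))" "integrable \<pi> (\<lambda>z. g (snd z))"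
      using gB by (auto intro!: \<pi>.integrable_const_bound[where B="\<bar>B\<bar>"])
    have "(LINT x:{a..b}|\<mu>. f x) - (LINT x:{a..b}|\<nu>. f x)
        = (LINT z|\<pi>. g (fst z)) - (LINT z|\<pi>. g (snd z))"
      unfolding set_lebesgue_integral_def g_def[symmetric]
      unfolding fst[symmetric] snd[symmetric] by (simp add: integral_distr)
    also have "\<dots> = (LINT z|\<pi>. g (fst z) - g (snd z))"
      using int by simp
    finally have "ennreal \<Delta> = ennreal (norm (LINT z|\<pi>. g (fst z) - g (snd z)))"
      by (simp add: \<Delta>_def)
    also have "\<dots> \<le> (\<integral>\<^sup>+ z. norm (g (fst z) - g (snd z)) \<partial>\<pi>)"
      using int by (intro integral_norm_bound_ennreal) auto
    also have "\<dots> \<le> (\<integral>\<^sup>+ z. ennreal K * ennreal \<bar>fst z - snd z\<bar> \<partial>\<pi>)"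
      using p(2)
    proof (intro nn_integral_mono_AE, eventually_elim)
      case (elim z)
      then show ?case
        using lipschitz_onD[OF f, of "fst z" "snd z"] K
        by (auto simp: g_def dist_real_def ennreal_mult[symmetric] intro!: ennreal_leI)
    qed
    also have "\<dots> = ennreal K * ?c \<pi>"
      by (intro nn_integral_cmult) measurable
    finally show ?thesis .
  qed
  have prod: "\<mu> \<Otimes>\<^sub>M \<nu> \<in> couplings \<mu> \<nu>"
    using \<mu> \<nu> by (rule pair_measure_in_couplings)
  show ?thesis
  \<comment> \<open>For positive \<open>K\<close> the constant is divided out before the infimum is
    taken. For \<open>K = 0\<close> a single coupling already forces \<open>\<Delta>\<close> to
    vanish.\<close>
  proof (cases "K = 0")
    case True
    then show ?thesis using le[OF prod] by (simp add: \<Delta>_def)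
  next
    case False
    with K have K: "0 < K" by simp
    have "ennreal (\<Delta> / K) \<le> ?c \<pi>" if "\<pi> \<in> couplings \<mu> \<nu>" for \<pi>
    proof -
      have "?c \<pi> < \<top>"
        using couplings_concentrated(3)[OF \<mu> \<nu> that] by (rule le_less_trans) simp
      then obtain r where r: "0 \<le> r" "?c \<pi> = ennreal r" by (cases "?c \<pi>") auto
      have "\<Delta> \<le> K * r" using le[OF that] r K by (simp add: ennreal_mult[symmetric])
      then show ?thesis using K r by (auto simp: field_simps intro!: ennreal_leI)
    qed
    then have 1: "ennreal (\<Delta> / K) \<le> wasserstein1 \<mu> \<nu>"
      unfolding wasserstein1_def by (intro INF_greatest)
    \<comment> \<open>Passing to reals with \<open>enn2real\<close> is monotone only below a finite
      bound; the product coupling supplies one.\<close>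
    have "wasserstein1 \<mu> \<nu> \<le> ?c (\<mu> \<Otimes>\<^sub>M \<nu>)"
      unfolding wasserstein1_def using prod by (intro INF_lower)
    also have "\<dots> < \<top>"
      using couplings_concentrated(3)[OF \<mu> \<nu> prod] by (rule le_less_trans) simp
    finally have "enn2real (ennreal (\<Delta> / K)) \<le> enn2real (wasserstein1 \<mu> \<nu>)"
      using 1 by (intro enn2real_mono)
    then show ?thesis using K by (simp add: \<Delta>_def field_simps)
  qed
qed

section \<open>Independence under the time integral and the quadratic cost\<close>

text \<open>At the random time \<open>t + a \<omega>\<close> the independence of \<open>a\<close>
  from each single \<open>X s\<close> cannot be applied directly. Substituting
  \<open>s = t + a \<omega>\<close> moves the randomness of the time into the weight
  \<open>\<psi> (s - a \<omega>)\<close>, which is independent of \<open>X s\<close>; so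
  \<open>X s\<close> may be replaced by its mean, and the substitution is undone.\<close>

lemma random_time_integral:
  fixes M :: "'w measure" and X :: "real \<Rightarrow> 'w \<Rightarrow> real" and a :: "'w \<Rightarrow> real" and \<psi> :: "real \<Rightarrow> real"
  defines "m \<equiv> \<lambda>t. LINT \<omega>|M. X t \<omega>"
  assumes M: "prob_space M"
    and a [measurable]: "a \<in> borel_measurable M"
    and X: "integrable (lborel \<Otimes>\<^sub>M M) (\<lambda>z. X (fst z) (snd z))"
    and indep: "\<And>t. prob_space.indep_var M borel a borel (X t)"
    and \<psi> [measurable]: "\<psi> \<in> borel_measurable borel" and \<psi>C: "\<And>t. \<bar>\<psi> t\<bar> \<le> C"
  shows "integrable (lborel \<Otimes>\<^sub>M M) (\<lambda>z. \<psi> (fst z) * X (fst z + a (snd z)) (snd z))"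
    and "integrable (lborel \<Otimes>\<^sub>M M) (\<lambda>z. \<psi> (fst z) * m (fst z + a (snd z)))"
    and "(LINT z|(lborel \<Otimes>\<^sub>M M). \<psi> (fst z) * X (fst z + a (snd z)) (snd z))
       = (LINT z|(lborel \<Otimes>\<^sub>M M). \<psi> (fst z) * m (fst z + a (snd z)))"
proof -
  interpret prob_space M by fact
  interpret pair_sigma_finite lborel M ..
  let ?Q = "lborel \<Otimes>\<^sub>M M"
  let ?S = "\<lambda>(t, \<omega>). (t + a \<omega>, \<omega>)"
  have S [measurable]: "?S \<in> measurable ?Q ?Q" by measurable
  have shear: "distr ?Q ?Q ?S = ?Q"
    by (rule distr_lborel_pair_shear) (unfold_locales, measurable)
  have [measurable]: "(\<lambda>z. X (fst z) (snd z)) \<in> borel_measurable ?Q"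
    using X by auto
  have m: "integrable lborel m"
    using integrable_fst'[OF X] by (simp add: m_def)
  then have [measurable]: "m \<in> borel_measurable borel" by auto
  have mQ: "integrable ?Q (\<lambda>z. m (fst z))"
    using m integrable_distr[of fst ?Q lborel m] by (simp add: distr_pair_fst)
  \<comment> \<open>\<open>F\<close> and \<open>G\<close> are the two integrands in the sheared
    variable: composing them with \<open>?S\<close> gives back the integrands of the claim.\<close>
  define F where "F = (\<lambda>z. \<psi> (fst z - a (snd z)) * X (fst z) (snd z))"
  define G where "G = (\<lambda>z. \<psi> (fst z - a (snd z)) * m (fst z))"
  have [measurable]: "F \<in> borel_measurable ?Q" "G \<in> borel_measurable ?Q"
    unfolding F_def G_def by measurable
  have F: "integrable ?Q F"
  proof (rule Bochner_Integration.integrable_bound)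
    show "integrable ?Q (\<lambda>z. C * X (fst z) (snd z))" using X by simp
    show "AE z in ?Q. norm (F z) \<le> norm (C * X (fst z) (snd z))"
      using \<psi>C by (auto simp: F_def abs_mult intro!: mult_right_mono order_trans[OF \<psi>C])
  qed measurable
  have G: "integrable ?Q G"
  proof (rule Bochner_Integration.integrable_bound)
    show "integrable ?Q (\<lambda>z. C * m (fst z))" using mQ by simp
    show "AE z in ?Q. norm (G z) \<le> norm (C * m (fst z))"
      using \<psi>C by (auto simp: G_def abs_mult intro!: mult_right_mono order_trans[OF \<psi>C])
  qed measurable
  have FS: "(\<lambda>z. \<psi> (fst z) * X (fst z + a (snd z)) (snd z)) = (\<lambda>z. F (?S z))"
    and GS: "(\<lambda>z. \<psi> (fst z) * m (fst z + a (snd z))) = (\<lambda>z. G (?S z))"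
    by (auto simp: F_def G_def)
  show "integrable ?Q (\<lambda>z. \<psi> (fst z) * X (fst z + a (snd z)) (snd z))"
    unfolding FS by (rule integrable_distr[OF S]) (simp add: shear F)
  show "integrable ?Q (\<lambda>z. \<psi> (fst z) * m (fst z + a (snd z)))"
    unfolding GS by (rule integrable_distr[OF S]) (simp add: shear G)
  \<comment> \<open>The product rule for expectations requires \<open>X t\<close> to be integrable,
    which Fubini grants for almost every \<open>t\<close>.\<close>
  have "AE t in lborel. (LINT \<omega>|M. F (t, \<omega>)) = (LINT \<omega>|M. G (t, \<omega>))"
    using AE_integrable_fst'[OF X]
  proof eventually_elim
    case (elim t)
    have "indep_var borel ((\<lambda>x. \<psi> (t - x)) \<circ> a) borel ((\<lambda>x. x) \<circ> X t)"
      by (rule indep_var_compose[OF indep]) measurable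
    then have "indep_var borel (\<lambda>\<omega>. \<psi> (t - a \<omega>)) borel (X t)"
      by (simp add: comp_def)
    moreover have "integrable M (\<lambda>\<omega>. \<psi> (t - a \<omega>))"
      using \<psi>C by (auto intro!: integrable_const_bound[where B=C])
    ultimately show ?case
      using elim by (simp add: F_def G_def m_def indep_var_lebesgue_integral)
  qed
  then have "(LINT t|lborel. LINT \<omega>|M. F (t, \<omega>)) = (LINT t|lborel. LINT \<omega>|M. G (t, \<omega>))"
    by (intro integral_cong_AE) measurable
  then have FG: "integral\<^sup>L ?Q F = integral\<^sup>L ?Q G"
    by (simp add: integral_fst'[OF F] integral_fst'[OF G])
  have "integral\<^sup>L ?Q F = (LINT z|?Q. F (?S z))"
    by (subst shear[symmetric], subst integral_distr) auto
  moreover have "integral\<^sup>L ?Q G = (LINT z|?Q. G (?S z))"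
    by (subst shear[symmetric], subst integral_distr) auto
  ultimately show "(LINT z|?Q. \<psi> (fst z) * X (fst z + a (snd z)) (snd z))
       = (LINT z|?Q. \<psi> (fst z) * m (fst z + a (snd z)))"
    unfolding FS GS using FG by simp
qed

text \<open>Expand the squares. The term in \<open>X\<close> squared is common to both costs and
  cancels, and each cross term becomes an integral against \<open>v\<close> by
  \<open>random_time_integral\<close>. What remains is the integral of
  \<open>u\<^sup>2 - 2 * u * v\<close> minus that of \<open>v\<^sup>2 - 2 * v * v\<close>, which is
  that of \<open>(u - v)\<^sup>2\<close>.\<close>

lemma quadratic_cost_diff:
  fixes M :: "'w measure" and X :: "real \<Rightarrow> 'w \<Rightarrow> real" and a :: "'w \<Rightarrow> real" and u :: "real \<Rightarrow> real"
  defines "m \<equiv> \<lambda>t. LINT \<omega>|M. X t \<omega>"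
  defines "v \<equiv> \<lambda>t. LINT \<omega>|M. m (t + a \<omega>)"
  assumes M: "prob_space M"
    and a [measurable]: "a \<in> borel_measurable M"
    and X: "integrable (lborel \<Otimes>\<^sub>M M) (\<lambda>z. X (fst z) (snd z))"
    and X2: "integrable (lborel \<Otimes>\<^sub>M M) (\<lambda>z. (X (fst z) (snd z))\<^sup>2)"
    and indep: "\<And>t. prob_space.indep_var M borel a borel (X t)"
    and J [measurable]: "J \<in> sets borel" and Jfin: "emeasure lborel J < \<infinity>"
    and u [measurable]: "u \<in> borel_measurable borel" and uC: "\<And>t. \<bar>u t\<bar> \<le> C"
    and mC: "\<And>t. \<bar>m t\<bar> \<le> C"
  shows "(LINT t:J|lborel. LINT \<omega>|M. (u t - X (t + a \<omega>) \<omega>)\<^sup>2)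
       - (LINT t:J|lborel. LINT \<omega>|M. (v t - X (t + a \<omega>) \<omega>)\<^sup>2)
       = (LINT t:J|lborel. (u t - v t)\<^sup>2)"
    and "set_integrable lborel J (\<lambda>t. (u t - v t)\<^sup>2)"
proof -
  interpret prob_space M by fact
  interpret pair_sigma_finite lborel M ..
  let ?Q = "lborel \<Otimes>\<^sub>M M"
  let ?S = "\<lambda>(t, \<omega>). (t + a \<omega>, \<omega>)"
  let ?I = "indicat_real J"
  have S [measurable]: "?S \<in> measurable ?Q ?Q" by measurable
  have shear: "distr ?Q ?Q ?S = ?Q"
    by (rule distr_lborel_pair_shear) (unfold_locales, measurable)
  have [measurable]: "(\<lambda>z. X (fst z) (snd z)) \<in> borel_measurable ?Q"
    using X by auto
  have m_int: "integrable lborel m"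
    using integrable_fst'[OF X] by (simp add: m_def)
  then have [measurable]: "m \<in> borel_measurable borel" by auto
  define Y where "Y z = X (fst z + a (snd z)) (snd z)" for z
  have Y_eq: "Y = (\<lambda>z. (\<lambda>z. X (fst z) (snd z)) (?S z))" by (auto simp: Y_def)
  have [measurable]: "Y \<in> borel_measurable ?Q"
    unfolding Y_eq by (rule measurable_compose[OF S]) measurable
  have Y2: "integrable ?Q (\<lambda>z. (Y z)\<^sup>2)"
  proof -
    have "(\<lambda>z. (Y z)\<^sup>2) = (\<lambda>z. (\<lambda>z. (X (fst z) (snd z))\<^sup>2) (?S z))" by (auto simp: Y_def)
    then show ?thesis using integrable_distr[OF S, of "\<lambda>z. (X (fst z) (snd z))\<^sup>2"] X2 shear by simp
  qed
  have [measurable]: "v \<in> borel_measurable borel" unfolding v_def by measurable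
  have C: "0 \<le> C" using order_trans[OF abs_ge_zero mC] .
  have m_int': "integrable M (\<lambda>\<omega>. m (t + a \<omega>))" for t
    using mC by (auto intro!: integrable_const_bound[where B=C])
  have vC: "\<bar>v t\<bar> \<le> C" for t
  proof -
    have "norm (v t) \<le> (LINT \<omega>|M. norm (m (t + a \<omega>)))"
      unfolding v_def by (rule integral_norm_bound)
    also have "\<dots> \<le> (LINT \<omega>|M. C)"
      using mC m_int' by (intro integral_mono) auto
    finally show ?thesis by (simp add: prob_space)
  qed
  have J_int: "integrable lborel ?I" using Jfin by simp
  have bnd_int: "integrable lborel (\<lambda>t. ?I t * w t)"
    if [measurable]: "w \<in> borel_measurable borel" and "\<And>t. \<bar>w t\<bar> \<le> K" for w :: "real \<Rightarrow> real" and K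
  proof (rule Bochner_Integration.integrable_bound)
    show "integrable lborel (\<lambda>t. K * ?I t)" using J_int by simp
    show "AE t in lborel. norm (?I t * w t) \<le> norm (K * ?I t)"
      by (auto simp: indicator_def intro!: AE_I2 order_trans[OF that(2) abs_ge_self])
  qed measurable
  have fst_int: "integrable ?Q (\<lambda>z. w (fst z))" "(LINT z|?Q. w (fst z)) = integral\<^sup>L lborel w"
    if "integrable lborel w" for w :: "real \<Rightarrow> real"
  proof -
    show "integrable ?Q (\<lambda>z. w (fst z))"
      using that integrable_distr[of fst ?Q lborel w] by (simp add: distr_pair_fst)
    show "(LINT z|?Q. w (fst z)) = integral\<^sup>L lborel w"
      using that integral_distr[of fst ?Q lborel w] by (simp add: distr_pair_fst)
  qed
  have sq: "\<bar>(w t)\<^sup>2\<bar> \<le> C\<^sup>2" if "\<And>t. \<bar>w t\<bar> \<le> C" for w :: "real \<Rightarrow> real" and t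
    using power_mono[OF that[of t], of 2] by simp
  have Y2J: "integrable ?Q (\<lambda>z. ?I (fst z) * (Y z)\<^sup>2)"
    by (rule Bochner_Integration.integrable_bound[OF Y2]) (auto simp: indicator_def)
  \<comment> \<open>\<open>random_time_integral\<close> with the weight \<open>w\<close> cut off
    outside \<open>J\<close>.\<close>
  have rti: "integrable ?Q (\<lambda>z. ?I (fst z) * w (fst z) * Y z)"
    "integrable ?Q (\<lambda>z. ?I (fst z) * w (fst z) * m (fst z + a (snd z)))"
    "(LINT z|?Q. ?I (fst z) * w (fst z) * Y z) =
       (LINT z|?Q. ?I (fst z) * w (fst z) * m (fst z + a (snd z)))"
    if [measurable]: "w \<in> borel_measurable borel" and w: "\<And>t. \<bar>w t\<bar> \<le> K" for w K
  proof -
    have "\<bar>?I t * w t\<bar> \<le> K" for t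
      using w[of t] by (auto simp: indicator_def)
    note r = random_time_integral[where \<psi>="\<lambda>t. ?I t * w t", OF M a X indep _ this]
    show "integrable ?Q (\<lambda>z. ?I (fst z) * w (fst z) * Y z)"
      "integrable ?Q (\<lambda>z. ?I (fst z) * w (fst z) * m (fst z + a (snd z)))"
      "(LINT z|?Q. ?I (fst z) * w (fst z) * Y z) =
       (LINT z|?Q. ?I (fst z) * w (fst z) * m (fst z + a (snd z)))"
      using r by (simp_all add: Y_def m_def)
  qed
  \<comment> \<open>Stated for any bounded Borel \<open>w\<close>, so that it serves for both
    \<open>u\<close> and \<open>v\<close>.\<close>
  have cost: "(LINT t:J|lborel. LINT \<omega>|M. (w t - X (t + a \<omega>) \<omega>)\<^sup>2) =
      (LINT t|lborel. ?I t * (w t)\<^sup>2) - 2 * (LINT z|?Q. ?I (fst z) * w (fst z) * Y z)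
        + (LINT z|?Q. ?I (fst z) * (Y z)\<^sup>2)"
    if [measurable]: "w \<in> borel_measurable borel" and w: "\<And>t. \<bar>w t\<bar> \<le> C" for w
  proof -
    have i: "integrable lborel (\<lambda>t. ?I t * (w t)\<^sup>2)"
      using sq[OF w] by (intro bnd_int) auto
    let ?h = "\<lambda>z. ?I (fst z) * (w (fst z))\<^sup>2 - 2 * (?I (fst z) * w (fst z) * Y z) + ?I (fst z) * (Y z)\<^sup>2"
    have h: "integrable ?Q ?h"
      using fst_int(1)[OF i] rti(1)[of w, OF _ w] Y2J by simp
    have "(LINT t:J|lborel. LINT \<omega>|M. (w t - X (t + a \<omega>) \<omega>)\<^sup>2) = (LINT t|lborel. LINT \<omega>|M. ?h (t, \<omega>))"
      unfolding set_lebesgue_integral_def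
      by (intro Bochner_Integration.integral_cong)
        (auto simp: indicator_def Y_def power2_diff algebra_simps)
    also have "\<dots> = integral\<^sup>L ?Q ?h" by (rule integral_fst'[OF h])
    also have "\<dots> = (LINT t|lborel. ?I t * (w t)\<^sup>2) - 2 * (LINT z|?Q. ?I (fst z) * w (fst z) * Y z)
        + (LINT z|?Q. ?I (fst z) * (Y z)\<^sup>2)"
      using fst_int[OF i] rti(1)[of w, OF _ w] Y2J by simp
    finally show ?thesis .
  qed
  \<comment> \<open>Once \<open>Y\<close> is replaced by \<open>m (t + a \<omega>)\<close>,
    integrating over \<open>\<omega>\<close> first yields \<open>v t\<close> by definition.\<close>
  have cross: "(LINT z|?Q. ?I (fst z) * w (fst z) * Y z) = (LINT t|lborel. ?I t * (w t * v t))"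
    if [measurable]: "w \<in> borel_measurable borel" and w: "\<And>t. \<bar>w t\<bar> \<le> C" for w
    using rti(3)[of w, OF _ w] integral_fst'[OF rti(2)[of w, OF _ w]]
    by (simp add: v_def mult.assoc)
  have uv: "\<bar>u t * v t\<bar> \<le> C * C" for t
    unfolding abs_mult using uC vC C by (intro mult_mono) auto
  have i: "integrable lborel (\<lambda>t. ?I t * (u t)\<^sup>2)" "integrable lborel (\<lambda>t. ?I t * (v t)\<^sup>2)"
    "integrable lborel (\<lambda>t. ?I t * (u t * v t))"
    using sq[OF uC] sq[OF vC] uv by (auto intro!: bnd_int)
  have e: "?I t *\<^sub>R (u t - v t)\<^sup>2 = ?I t * (u t)\<^sup>2 - 2 * (?I t * (u t * v t)) + ?I t * (v t)\<^sup>2" for t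
    by (simp add: power2_diff algebra_simps)
  show "set_integrable lborel J (\<lambda>t. (u t - v t)\<^sup>2)"
    unfolding set_integrable_def e using i by simp
  show "(LINT t:J|lborel. LINT \<omega>|M. (u t - X (t + a \<omega>) \<omega>)\<^sup>2)
       - (LINT t:J|lborel. LINT \<omega>|M. (v t - X (t + a \<omega>) \<omega>)\<^sup>2)
       = (LINT t:J|lborel. (u t - v t)\<^sup>2)"
    unfolding cost[OF u uC] cost[OF \<open>v \<in> borel_measurable borel\<close> vC]
      cross[OF u uC] cross[OF \<open>v \<in> borel_measurable borel\<close> vC]
    unfolding set_lebesgue_integral_def e using i by (simp add: power2_eq_square)
qed

section \<open>From the demand process to a process on the whole line\<close>

text \<open>The shear acts on all real times, so the process is extended by zero outside the open
  interval. The clamp \<open>max 0 (min T t)\<close> keeps every evaluation of \<open>D\<close>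
  inside \<open>{0..T}\<close>, where joint measurability is assumed.\<close>

lemma demand_process_extension:
  fixes D :: "real \<Rightarrow> 'w \<Rightarrow> real" and T :: real
  defines "E \<equiv> \<lambda>t \<omega>. indicator {0<..<T} t * D (max 0 (min T t)) \<omega>"
  assumes M: "prob_space M" and T: "0 < T" and D: "demand_process M T D"
  shows "integrable (lborel \<Otimes>\<^sub>M M) (\<lambda>z. E (fst z) (snd z))"
    and "integrable (lborel \<Otimes>\<^sub>M M) (\<lambda>z. (E (fst z) (snd z))\<^sup>2)"
proof -
  interpret prob_space M by fact
  interpret pair_sigma_finite lborel M ..
  let ?Q = "lborel \<Otimes>\<^sub>M M" and ?R = "restrict_space lborel {0<..<T}"
  have [measurable]: "(\<lambda>z. D (fst z) (snd z)) \<in> borel_measurable (restrict_space borel {0..T} \<Otimes>\<^sub>M M)"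
    and D2: "integrable (M \<Otimes>\<^sub>M ?R) (\<lambda>z. (D (snd z) (fst z))\<^sup>2)"
    using D by (simp_all add: demand_process_def case_prod_unfold)
  have clamp [measurable]: "(\<lambda>t. max 0 (min T t)) \<in> measurable borel (restrict_space borel {0..T})"
    using T by (intro measurable_restrict_space2) auto
  have "(\<lambda>z. (\<lambda>z. D (fst z) (snd z)) (max 0 (min T (fst z)), snd z)) \<in> borel_measurable ?Q"
    by (rule measurable_compose[where N="restrict_space borel {0..T} \<Otimes>\<^sub>M M"]) measurable
  then have [measurable]: "(\<lambda>z. D (max 0 (min T (fst z))) (snd z)) \<in> borel_measurable ?Q" by simp
  have E [measurable]: "(\<lambda>z. E (fst z) (snd z)) \<in> borel_measurable ?Q"
    unfolding E_def by measurable
  interpret R: finite_measure ?R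
    using T by (intro finite_measureI) (simp add: emeasure_restrict_space space_restrict_space)
  \<comment> \<open>Tonelli exchanges the order of integration, because
    \<open>demand_process\<close> puts the probability space first.\<close>
  have "(\<integral>\<^sup>+ z. ennreal ((E (fst z) (snd z))\<^sup>2) \<partial>?Q) = (\<integral>\<^sup>+ \<omega>. \<integral>\<^sup>+ t. ennreal ((E t \<omega>)\<^sup>2) \<partial>lborel \<partial>M)"
    by (subst nn_integral_snd[symmetric]) auto
  also have "\<dots> = (\<integral>\<^sup>+ \<omega>. \<integral>\<^sup>+ t. ennreal ((D t \<omega>)\<^sup>2) \<partial>?R \<partial>M)"
    by (intro nn_integral_cong)
      (auto simp: nn_integral_restrict_space E_def indicator_def intro!: nn_integral_cong)
  also have "\<dots> = (\<integral>\<^sup>+ z. ennreal ((D (snd z) (fst z))\<^sup>2) \<partial>(M \<Otimes>\<^sub>M ?R))"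
    using D2 by (subst R.nn_integral_fst[symmetric]) auto
  also have "\<dots> < \<infinity>"
    using D2 by (simp add: integrable_iff_bounded)
  finally show E2: "integrable ?Q (\<lambda>z. (E (fst z) (snd z))\<^sup>2)"
    by (intro integrableI_bounded) auto
  have "integrable lborel (indicat_real {0<..<T})" using T by simp
  then have I: "integrable ?Q (\<lambda>z. indicat_real {0<..<T} (fst z))"
    using integrable_distr[of fst ?Q lborel "indicat_real {0<..<T}"] by (simp add: distr_pair_fst)
  show "integrable ?Q (\<lambda>z. E (fst z) (snd z))"
  proof (rule Bochner_Integration.integrable_bound)
    show "integrable ?Q (\<lambda>z. indicat_real {0<..<T} (fst z) + (E (fst z) (snd z))\<^sup>2)"
      using I E2 by simp
    \<comment> \<open>Square integrability yields integrability since the time strip has finite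
      measure; the constant 1 is integrated only over that strip.\<close>
    have "\<bar>x\<bar> \<le> \<bar>1 + x\<^sup>2\<bar>" for x :: real
    proof -
      have "0 \<le> (\<bar>x\<bar> - 1)\<^sup>2" by simp
      then show ?thesis by (simp add: power2_diff)
    qed
    then show "AE z in ?Q. norm (E (fst z) (snd z)) \<le>
        norm (indicat_real {0<..<T} (fst z) + (E (fst z) (snd z))\<^sup>2)"
      by (auto simp: E_def indicator_def)
  qed measurable
qed

text \<open>Preimages under one \<open>D t\<close> generate a sub-sigma-algebra of that of the whole
  process, and independence passes to it.\<close>

lemma velocity_indep_var:
  assumes M: "prob_space M" and D: "demand_process M T D"
    and \<Lambda>: "velocity M lmin lmax T D \<mu> \<Lambda>" and t: "t \<in> {0..T}"
  shows "prob_space.indep_var M borel \<Lambda> borel (D t)"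
proof -
  interpret prob_space M by fact
  have [measurable]: "\<Lambda> \<in> borel_measurable M"
    and ind: "indep_set (sigma_process M {()} (\<lambda>_. \<Lambda>)) (sigma_process M {0..T} D)"
    using \<Lambda> by (auto simp: velocity_def)
  have D': "(\<lambda>z. D (fst z) (snd z)) \<in> borel_measurable (restrict_space borel {0..T} \<Otimes>\<^sub>M M)"
    using D by (simp add: demand_process_def case_prod_unfold)
  have "(\<lambda>\<omega>. (t, \<omega>)) \<in> measurable M (restrict_space borel {0..T} \<Otimes>\<^sub>M M)"
    using t by (intro measurable_Pair1') (simp add: space_restrict_space)
  from measurable_compose[OF this D'] have [measurable]: "D t \<in> borel_measurable M" by simp
  have "sigma_sets (space M) {D t -` A \<inter> space M |A. A \<in> sets borel} \<subseteq> sigma_process M {0..T} D"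
    unfolding sigma_process_def using t by (intro sigma_sets_mono') blast
  then have "indep_set (sigma_sets (space M) {\<Lambda> -` A \<inter> space M |A. A \<in> sets borel})
     (sigma_sets (space M) {D t -` A \<inter> space M |A. A \<in> sets borel})"
    using ind unfolding indep_set_def
    by (rule_tac indep_sets_mono_sets) (auto simp: sigma_process_def split: bool.split)
  then show ?thesis by (simp add: indep_var_eq)
qed

text \<open>On \<open>{a..b}\<close> the map \<open>l \<mapsto> 1 / l\<close> has Lipschitz constant
  \<open>1 / a\<^sup>2\<close>, because
  \<open>\<bar>1 / x - 1 / y\<bar> = \<bar>x - y\<bar> / (x * y)\<close> and both factors are at
  least \<open>a\<close>.\<close>

lemma lipschitz_on_shift_inverse:
  fixes f :: "real \<Rightarrow> real"
  assumes f: "L-lipschitz_on S f" and a: "0 < a" and S: "\<And>l. l \<in> {a..b} \<Longrightarrow> t + 1 / l \<in> S"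
  shows "(L / a\<^sup>2)-lipschitz_on {a..b} (\<lambda>l. f (t + 1 / l))"
proof (rule lipschitz_onI)
  have L: "0 \<le> L" using f by (rule lipschitz_on_nonneg)
  then show "0 \<le> L / a\<^sup>2" by simp
  fix x y assume xy: "x \<in> {a..b}" "y \<in> {a..b}"
  with a have pos: "0 < x" "0 < y" by auto
  have "dist (f (t + 1 / x)) (f (t + 1 / y)) \<le> L * dist (t + 1 / x) (t + 1 / y)"
    using xy S by (intro lipschitz_onD[OF f]) auto
  also have "dist (t + 1 / x) (t + 1 / y) = \<bar>x - y\<bar> / (x * y)"
  proof -
    have "1 / x - 1 / y = (y - x) / (x * y)" using pos by (simp add: field_simps)
    then show ?thesis using pos by (simp add: dist_real_def abs_mult abs_minus_commute)
  qed
  also have "\<dots> \<le> \<bar>x - y\<bar> / a\<^sup>2"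
    using xy a by (intro divide_left_mono) (auto simp: power2_eq_square intro!: mult_mono mult_pos_pos)
  finally show "dist (f (t + 1 / x)) (f (t + 1 / y)) \<le> L / a\<^sup>2 * dist x y"
    using L by (simp add: mult_left_mono dist_real_def)
qed

section \<open>Excess cost of a misspecified velocity law\<close>

theorem corollary4p4:
  fixes M :: "'w measure"
    and D :: "real \<Rightarrow> 'w \<Rightarrow> real"
    and \<Lambda> :: "'w \<Rightarrow> real"
    and \<mu> \<nu> :: "real measure"
    and lmin lmax T L\<^sub>m c d :: real
  assumes "0 < lmin" and "lmin < lmax" and "0 < T"
    and "I_int lmin lmax T \<noteq> {}"
    and "prob_space M"
    and "demand_process M T D"
    and "prob_supported_on {lmin..lmax} \<mu>"
    and "prob_supported_on {lmin..lmax} \<nu>"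
    and "velocity M lmin lmax T D \<mu> \<Lambda>"
    and "c \<le> d" and "{c..d} \<subseteq> interior (I_int lmin lmax T)"
    and "L\<^sub>m-lipschitz_on {0..T} (mean_demand M D)"
  shows "0 \<le> H_cost M D \<Lambda> {c..d} (u_star M D lmin lmax \<nu>)
             - H_cost M D \<Lambda> {c..d} (u_star M D lmin lmax \<mu>)
       \<and> H_cost M D \<Lambda> {c..d} (u_star M D lmin lmax \<nu>)
             - H_cost M D \<Lambda> {c..d} (u_star M D lmin lmax \<mu>)
           \<le> L\<^sub>m\<^sup>2 * (d - c) / lmin ^ 4 * (enn2real (wasserstein1 \<mu> \<nu>))\<^sup>2"
proof -
  note l = \<open>0 < lmin\<close> \<open>lmin < lmax\<close> and D = \<open>demand_process M T D\<close>
    and \<mu> = \<open>prob_supported_on {lmin..lmax} \<mu>\<close> and \<nu> = \<open>prob_supported_on {lmin..lmax} \<nu>\<close>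
    and vel = \<open>velocity M lmin lmax T D \<mu> \<Lambda>\<close> and lip = \<open>L\<^sub>m-lipschitz_on {0..T} (mean_demand M D)\<close>
  interpret prob_space M by fact
  have [measurable_cong]: "sets \<nu> = sets borel" using \<nu> by (simp add: prob_supported_on_def)
  interpret \<nu>: prob_space \<nu> using \<nu> by (simp add: prob_supported_on_def)
  have \<Lambda> [measurable]: "\<Lambda> \<in> borel_measurable M" and \<Lambda>_in: "\<And>\<omega>. \<omega> \<in> space M \<Longrightarrow> \<Lambda> \<omega> \<in> {lmin..lmax}"
    and \<Lambda>_law: "distr M borel \<Lambda> = \<mu>"
    using vel by (auto simp: velocity_def)
  define E where "E t \<omega> = indicator {0<..<T} t * D (max 0 (min T t)) \<omega>" for t \<omega>
  define m where "m t = (LINT \<omega>|M. E t \<omega>)" for t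
  define a where "a \<omega> = 1 / \<Lambda> \<omega>" for \<omega>
  \<comment> \<open>\<open>u\<close> and \<open>v\<close> stand in for \<open>u_star\<close> of
    \<open>\<nu>\<close> and \<open>\<mu>\<close>. They are built from the extended mean
    \<open>m\<close>, hence bounded and Borel on the whole line, and agree with
    \<open>u_star\<close> on \<open>{c..d}\<close>.\<close>
  define u where "u t = (LINT x|\<nu>. indicator {lmin..lmax} x * m (t + 1 / x))" for t
  define v where "v t = (LINT \<omega>|M. m (t + a \<omega>))" for t
  have [measurable]: "a \<in> borel_measurable M" unfolding a_def by measurable
  have E1: "integrable (lborel \<Otimes>\<^sub>M M) (\<lambda>z. E (fst z) (snd z))"
    and E2: "integrable (lborel \<Otimes>\<^sub>M M) (\<lambda>z. (E (fst z) (snd z))\<^sup>2)"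
    unfolding E_def by (rule demand_process_extension; fact)+
  have indep: "indep_var borel a borel (E t)" for t
  proof -
    have "indep_var borel \<Lambda> borel (D (max 0 (min T t)))"
      using \<open>0 < T\<close> by (intro velocity_indep_var[OF _ D vel]) (auto intro: prob_space_axioms)
    then have "indep_var borel ((\<lambda>x. 1 / x) \<circ> \<Lambda>) borel
        ((\<lambda>x. indicator {0<..<T} t * x) \<circ> D (max 0 (min T t)))"
      by (rule indep_var_compose) measurable
    then show ?thesis by (simp add: comp_def a_def[abs_def] E_def[abs_def])
  qed
  \<comment> \<open>The end points of \<open>I_int\<close> are chosen for this: adding a travel time
    between \<open>1 / lmax\<close> and \<open>1 / lmin\<close> keeps the time above
    \<open>1 / lmin\<close> and below \<open>T\<close>. Strictness comes from the interior, so
    \<open>E\<close> and \<open>D\<close> agree at every time the cost evaluates.\<close>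
  have inside: "t + 1 / x \<in> {0<..<T}" if "t \<in> {c..d}" "x \<in> {lmin..lmax}" for t x
  proof -
    have "t \<in> {1 / lmin - 1 / lmax <..< T - 1 / lmin}"
      using that(1) \<open>{c..d} \<subseteq> interior (I_int lmin lmax T)\<close>
      by (auto simp: I_int_def interior_atLeastAtMost_real)
    moreover have "1 / lmax \<le> 1 / x" "1 / x \<le> 1 / lmin" "0 < 1 / lmin"
      using that(2) l by (auto simp: field_simps)
    ultimately show ?thesis
      unfolding greaterThanLessThan_iff by linarith
  qed
  have E_eq: "E t = D t" if "t \<in> {0<..<T}" for t
    using that by (auto simp: E_def)
  then have m_eq: "m t = mean_demand M D t" if "t \<in> {0<..<T}" for t
    using that by (simp add: m_def mean_demand_def)
  have [measurable]: "m \<in> borel_measurable borel"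
  proof -
    interpret pair_sigma_finite lborel M ..
    show ?thesis using integrable_fst'[OF E1] by (auto simp: m_def[abs_def])
  qed
  \<comment> \<open>A Lipschitz mean is bounded on the compact \<open>{0..T}\<close>, and
    \<open>m\<close> vanishes outside the open interval.\<close>
  obtain C where mC: "\<And>t. \<bar>m t\<bar> \<le> C"
  proof -
    have "bounded (mean_demand M D ` {0..T})"
      by (intro compact_imp_bounded compact_continuous_image lipschitz_on_continuous_on[OF lip]) auto
    then obtain B where B: "\<And>x. x \<in> {0..T} \<Longrightarrow> norm (mean_demand M D x) \<le> B"
      unfolding bounded_iff by blast
    have "\<bar>m t\<bar> \<le> \<bar>B\<bar>" for t
    proof (cases "t \<in> {0<..<T}")
      case True
      then show ?thesis using B[of t] by (auto simp: m_eq)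
    next
      case False
      then show ?thesis by (simp add: m_def E_def)
    qed
    then show ?thesis by (rule that)
  qed
  have C: "0 \<le> C" using order_trans[OF abs_ge_zero mC] .
  have [measurable]: "u \<in> borel_measurable borel" unfolding u_def by measurable
  have uC: "\<bar>u t\<bar> \<le> C" for t
  proof -
    have b: "norm (indicator {lmin..lmax} x * m (t + 1 / x)) \<le> C" for x
      using mC C by (auto simp: indicator_def)
    then have i: "integrable \<nu> (\<lambda>x. indicator {lmin..lmax} x * m (t + 1 / x))"
      by (intro \<nu>.integrable_const_bound[where B=C]) auto
    have "norm (u t) \<le> (LINT x|\<nu>. norm (indicator {lmin..lmax} x * m (t + 1 / x)))"
      unfolding u_def by (rule integral_norm_bound)
    also have "\<dots> \<le> (LINT x|\<nu>. C)"
      using b i by (intro integral_mono) auto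
    finally show ?thesis by (simp add: \<nu>.prob_space)
  qed
  have u_eq: "u_star M D lmin lmax \<nu> t = u t" if "t \<in> {c..d}" for t
    unfolding u_star_def u_def set_lebesgue_integral_def using m_eq inside[OF that]
    by (intro Bochner_Integration.integral_cong) (auto simp: indicator_def)
  have v_eq: "u_star M D lmin lmax \<mu> t = v t" if "t \<in> {c..d}" for t
  proof -
    have "u_star M D lmin lmax \<mu> t = (LINT x|\<mu>. indicator {lmin..lmax} x * m (t + 1 / x))"
      unfolding u_star_def set_lebesgue_integral_def using m_eq inside[OF that]
      by (intro Bochner_Integration.integral_cong) (auto simp: indicator_def)
    \<comment> \<open>Here the law of \<open>\<Lambda>\<close> enters: an integral against
      \<open>\<mu>\<close> becomes an expectation over \<open>\<omega>\<close>.\<close>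
    also have "\<dots> = (LINT \<omega>|M. indicator {lmin..lmax} (\<Lambda> \<omega>) * m (t + 1 / \<Lambda> \<omega>))"
      unfolding \<Lambda>_law[symmetric] by (rule integral_distr) measurable
    also have "\<dots> = v t"
      unfolding v_def a_def using \<Lambda>_in by (intro Bochner_Integration.integral_cong) auto
    finally show ?thesis .
  qed
  have H_eq: "H_cost M D \<Lambda> {c..d} f = (LINT t:{c..d}|lborel. LINT \<omega>|M. (g t - E (t + a \<omega>) \<omega>)\<^sup>2)"
    if "\<And>t. t \<in> {c..d} \<Longrightarrow> f t = g t" for f g
    unfolding H_cost_def a_def using that E_eq inside \<Lambda>_in
    by (intro set_lebesgue_integral_cong) (auto intro!: Bochner_Integration.integral_cong)
  have Hu: "H_cost M D \<Lambda> {c..d} (u_star M D lmin lmax \<nu>)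
      = (LINT t:{c..d}|lborel. LINT \<omega>|M. (u t - E (t + a \<omega>) \<omega>)\<^sup>2)"
    using u_eq by (rule H_eq)
  have Hv: "H_cost M D \<Lambda> {c..d} (u_star M D lmin lmax \<mu>)
      = (LINT t:{c..d}|lborel. LINT \<omega>|M. (v t - E (t + a \<omega>) \<omega>)\<^sup>2)"
    using v_eq by (rule H_eq)
  note q = quadratic_cost_diff[where M=M and a=a and X=E and u=u and C=C and J="{c..d}", folded m_def, folded v_def,
      OF prob_space_axioms _ E1 E2 indep _ _ _ uC mC]
  have diff: "H_cost M D \<Lambda> {c..d} (u_star M D lmin lmax \<nu>) - H_cost M D \<Lambda> {c..d} (u_star M D lmin lmax \<mu>)
      = (LINT t:{c..d}|lborel. (u t - v t)\<^sup>2)"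
    and int: "set_integrable lborel {c..d} (\<lambda>t. (u t - v t)\<^sup>2)"
    using q \<open>c \<le> d\<close>
    by (simp_all add: Hu Hv)
  \<comment> \<open>\<open>L\<^sub>m / lmin\<^sup>2\<close> is the Lipschitz constant of
    \<open>l \<mapsto> m (t + 1 / l)\<close>. Squaring \<open>K\<close> produces
    \<open>lmin ^ 4\<close> and the squared distance; integrating over \<open>{c..d}\<close> adds
    the length.\<close>
  define K where "K = L\<^sub>m / lmin\<^sup>2 * enn2real (wasserstein1 \<mu> \<nu>)"
  have "(u t - v t)\<^sup>2 \<le> K\<^sup>2" if t: "t \<in> {c..d}" for t
  proof -
    have "t + 1 / x \<in> {0..T}" if "x \<in> {lmin..lmax}" for x
      using inside[OF t that] by auto
    then have "\<bar>v t - u t\<bar> \<le> K"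
      using set_integral_diff_le_wasserstein1[OF \<mu> \<nu> lipschitz_on_shift_inverse[OF lip \<open>0 < lmin\<close>, of lmax t]]
      by (simp add: K_def u_eq[OF t, symmetric] v_eq[OF t, symmetric] u_star_def)
    then show ?thesis by (simp add: abs_le_square_iff[symmetric] abs_minus_commute)
  qed
  then have "(LINT t:{c..d}|lborel. (u t - v t)\<^sup>2) \<le> (LINT t:{c..d}|lborel. K\<^sup>2)"
    using int \<open>c \<le> d\<close>
    by (intro set_integral_mono) (auto simp: set_integrable_def intro!: integrable_real_indicator)
  also have "\<dots> = K\<^sup>2 * (d - c)"
    using \<open>c \<le> d\<close> by (simp add: set_lebesgue_integral_def)
  also have "\<dots> = L\<^sub>m\<^sup>2 * (d - c) / lmin ^ 4 * (enn2real (wasserstein1 \<mu> \<nu>))\<^sup>2"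
    by (simp add: K_def power_mult_distrib power_divide power_mult[symmetric])
  finally have "(LINT t:{c..d}|lborel. (u t - v t)\<^sup>2)
      \<le> L\<^sub>m\<^sup>2 * (d - c) / lmin ^ 4 * (enn2real (wasserstein1 \<mu> \<nu>))\<^sup>2" .
  moreover have "0 \<le> (LINT t:{c..d}|lborel. (u t - v t)\<^sup>2)"
    unfolding set_lebesgue_integral_def by (intro Bochner_Integration.integral_nonneg) auto
  ultimately show ?thesis unfolding diff by simp
qed

end
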